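(* Let $k \ge 4$ be an integer and let $D$ be a $k$-partite tournament. Then the niche graph $\mathcal{N}(D)$ is connected.
   Context: A $k$-partite tournament is an orientation of a complete $k$-partite graph (with $k$ nonempty partite sets): for any two vertices in different partite sets exactly one of the arcs $(u,v)$, $(v,u)$ is present, and there are no arcs inside a partite set. The niche graph $\mathcal{N}(D)$ of a digraph $D$ has vertex set $V(D)$, and two distinct vertices $u,v$ are adjacent iff there is $w\in V(D)$ with $(u,w),(v,w)\in A(D)$, or there is $w \in V(D)$ with $(w,u),(w,v)\in A(D)$. *)

theory Defs
  imports "Graph_Theory.Digraph_Component" "HOL-Library.Disjoint_Sets"
begin

text \<open>
  The vertex set is not required to be finite. The conjunct \<open>finite P\<close> is needed only to keep
  \<open>card P = k\<close> meaningful for \<open>k = 0\<close>.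
\<close>

definition partite_tournament :: "nat \<Rightarrow> 'a pair_pre_digraph \<Rightarrow> bool" where
  "partite_tournament k D \<longleftrightarrow>
     pair_wf_digraph D \<and>
     (\<exists>P. partition_on (pverts D) P \<and> finite P \<and> card P = k \<and>
        (\<forall>U\<in>P. \<forall>u\<in>U. \<forall>v\<in>U. (u, v) \<notin> parcs D) \<and>
        (\<forall>U\<in>P. \<forall>V\<in>P. U \<noteq> V \<longrightarrow>
           (\<forall>u\<in>U. \<forall>v\<in>V. ((u, v) \<in> parcs D) \<noteq> ((v, u) \<in> parcs D))))"

text \<open>
  As usual in \<open>Graph_Theory\<close>, an undirected simple graph is represented by a symmetric loop-free
  digraph.
\<close>

definition niche_graph :: "'a pair_pre_digraph \<Rightarrow> 'a pair_pre_digraph" where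
  "niche_graph D =
     \<lparr> pverts = pverts D,
       parcs = {(u, v). u \<in> pverts D \<and> v \<in> pverts D \<and> u \<noteq> v \<and>
         ((\<exists>w\<in>pverts D. (u, w) \<in> parcs D \<and> (v, w) \<in> parcs D) \<or>
          (\<exists>w\<in>pverts D. (w, u) \<in> parcs D \<and> (w, v) \<in> parcs D))} \<rparr>"

lemma pair_bidirected_digraph_niche_graph: "pair_bidirected_digraph (niche_graph D)"
  by unfold_locales (auto simp: niche_graph_def symmetric_def sym_def)

end

theory Submission
  imports Defs
begin

text \<open>
  The out-neighbours of a vertex lie in one component of the niche graph, and so do its
  in-neighbours. A colouring of a tournament on four vertices that is constant on all in- and
  out-neighbourhoods is constant, so any four vertices from distinct partite sets lie in one
  component. As \<open>k \<ge> 4\<close>, any two vertices of different partite sets extend to such a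
  quadruple, and two vertices of the same partite set are linked through a third vertex outside it.
\<close>

text \<open>If \<open>c\<close> is not constant, vertices of different colours lie on opposite sides
  of every other vertex. For a 3-1 split, each vertex of the class of three then has out-degree 0 or
  2 inside it, but these degrees sum to 3. For a 2-2 split, let \<open>a\<close> dominate
  \<open>b\<close> in one class: the other class dominates \<open>a\<close> and is dominated by
  \<open>b\<close>, so a vertex of it cannot have its partner opposite to both.\<close>

lemma tournament_on_4_colour_eq:
  fixes A :: "'a rel" and c :: "'a \<Rightarrow> bool"
  assumes tournament:
      "(u, v) \<in> A \<longleftrightarrow> (v, u) \<notin> A" "(u, x) \<in> A \<longleftrightarrow> (x, u) \<notin> A" "(u, y) \<in> A \<longleftrightarrow> (y, u) \<notin> A"
      "(v, x) \<in> A \<longleftrightarrow> (x, v) \<notin> A" "(v, y) \<in> A \<longleftrightarrow> (y, v) \<notin> A" "(x, y) \<in> A \<longleftrightarrow> (y, x) \<notin> A"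
    and out: "\<And>w p q. (w, p) \<in> A \<Longrightarrow> (w, q) \<in> A \<Longrightarrow> c p = c q"
    and "in": "\<And>w p q. (p, w) \<in> A \<Longrightarrow> (q, w) \<in> A \<Longrightarrow> c p = c q"
  shows "c u = c v"
proof -
  have same: "((w, p) \<in> A \<longleftrightarrow> (w, q) \<in> A) \<longrightarrow> c p = c q"
    if "(w, p) \<in> A \<longleftrightarrow> (p, w) \<notin> A" "(w, q) \<in> A \<longleftrightarrow> (q, w) \<notin> A" for w p q
    using out "in" that by blast
  \<comment> \<open>All 12 choices of a vertex and a pair of others; the rest is
    propositional.\<close>
  show ?thesis
    using tournament same[of x u v] same[of y u v] same[of u v x] same[of u v y] same[of u x y]
      same[of v u x] same[of v u y] same[of v x y] same[of x u y] same[of x v y]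
      same[of y u x] same[of y v x]
    by sat
qed

text \<open>The case \<open>U = V\<close> is included, hence only a bound on
  \<open>card {U, V}\<close>.\<close>

lemma obtain_two_outside:
  assumes "finite P" "card P \<ge> 4" "U \<in> P" "V \<in> P"
  obtains X Y where "X \<in> P" "Y \<in> P" "X \<noteq> Y" "X \<notin> {U, V}" "Y \<notin> {U, V}"
proof -
  have "card {U, V} \<le> 2"
    by (simp add: card_insert_le_m1)
  then have "card (P - {U, V}) \<ge> 2"
    using assms diff_card_le_card_Diff[of "{U, V}" P] by simp
  then obtain S where "S \<subseteq> P - {U, V}" "card S = 2"
    by (meson obtain_subset_with_card_n)
  then show thesis
    using that by (auto simp: card_2_iff)
qed

text \<open>Reachability, being reflexive, also covers \<open>p = q\<close>, where there is no niche
  arc; the colouring hypotheses \<open>out\<close> and \<open>in\<close> include that case.\<close>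

lemma niche_graph_reachable_common_neighbour:
  assumes "pair_wf_digraph D"
    and "(w, p) \<in> parcs D \<and> (w, q) \<in> parcs D \<or> (p, w) \<in> parcs D \<and> (q, w) \<in> parcs D"
  shows "p \<rightarrow>\<^sup>*\<^bsub>with_proj (niche_graph D)\<^esub> q"
proof -
  interpret D: pair_wf_digraph D by fact
  interpret N: pair_bidirected_digraph "niche_graph D"
    by (rule pair_bidirected_digraph_niche_graph)
  have verts: "w \<in> pverts D" "p \<in> pverts D" "q \<in> pverts D"
    using assms(2) D.wellformed' by blast+
  show ?thesis
  proof (cases "p = q")
    case True
    then show ?thesis
      using verts N.reachable_refl by (simp add: niche_graph_def)
  next
    case False
    then have "(p, q) \<in> parcs (niche_graph D)"
      using assms(2) verts by (auto simp: niche_graph_def)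
    then show ?thesis
      using N.reachable_adjI by simp
  qed
qed

theorem theorem2p6:
  fixes k :: nat and D :: "'a pair_pre_digraph"
  assumes "k \<ge> 4" and "partite_tournament k D"
  shows "Digraph_Component.connected (with_proj (niche_graph D))"
proof -
  from assms(2) obtain P where wf: "pair_wf_digraph D" and P: "partition_on (pverts D) P"
    and finP: "finite P" and "card P = k"
    and *: "\<forall>U\<in>P. \<forall>V\<in>P. U \<noteq> V \<longrightarrow>
      (\<forall>u\<in>U. \<forall>v\<in>V. ((u, v) \<in> parcs D) \<noteq> ((v, u) \<in> parcs D))"
    unfolding partite_tournament_def by (elim conjE exE) rule
  have cardP: "card P \<ge> 4"
    using \<open>card P = k\<close> assms(1) by simp
  have tournament: "(u, v) \<in> parcs D \<longleftrightarrow> (v, u) \<notin> parcs D"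
    if "U \<in> P" "V \<in> P" "U \<noteq> V" "u \<in> U" "v \<in> V" for U V u v
    using *[rule_format, OF that] by simp
  let ?N = "with_proj (niche_graph D)"
  interpret N: pair_bidirected_digraph "niche_graph D"
    by (rule pair_bidirected_digraph_niche_graph)
  have verts_N: "pverts (niche_graph D) = \<Union>P"
    using P by (simp add: niche_graph_def partition_on_def)
  have nonempty: "\<exists>x. x \<in> X" if "X \<in> P" for X
    using P that by (metis all_not_in_conv partition_on_def)
  note common = niche_graph_reachable_common_neighbour[OF wf]

  have diff: "u \<rightarrow>\<^sup>*\<^bsub>?N\<^esub> v"
    if UV: "U \<in> P" "V \<in> P" "U \<noteq> V" "u \<in> U" "v \<in> V" for U V u v
  proof -
    obtain X Y where XY: "X \<in> P" "Y \<in> P" "X \<noteq> Y" "X \<notin> {U, V}" "Y \<notin> {U, V}"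
      using obtain_two_outside[OF finP cardP UV(1,2)] .
    obtain x y where xy: "x \<in> X" "y \<in> Y"
      using nonempty XY by blast
    \<comment> \<open>One orientation per pair, since the general equivalence would loop as a
      rewrite rule.\<close>
    note arcs = tournament[OF UV] tournament[of X U x u] tournament[of Y U y u]
      tournament[of X V x v] tournament[of Y V y v] tournament[of X Y x y]
    \<comment> \<open>The colouring is reachability from \<open>u\<close>, which holds at
      \<open>u\<close> itself.\<close>
    have "(u \<rightarrow>\<^sup>*\<^bsub>?N\<^esub> u) = (u \<rightarrow>\<^sup>*\<^bsub>?N\<^esub> v)"
    proof (rule tournament_on_4_colour_eq[where x = x and y = y and A = "parcs D"])
      show "(u \<rightarrow>\<^sup>*\<^bsub>?N\<^esub> p) = (u \<rightarrow>\<^sup>*\<^bsub>?N\<^esub> q)"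
        if "(w, p) \<in> parcs D" "(w, q) \<in> parcs D" for w p q
        using common[of w] that N.reachable_trans by blast
      show "(u \<rightarrow>\<^sup>*\<^bsub>?N\<^esub> p) = (u \<rightarrow>\<^sup>*\<^bsub>?N\<^esub> q)"
        if "(p, w) \<in> parcs D" "(q, w) \<in> parcs D" for w p q
        using common[of w] that N.reachable_trans by blast
    qed (use UV XY xy in \<open>simp_all add: arcs\<close>)
    moreover have "u \<rightarrow>\<^sup>*\<^bsub>?N\<^esub> u"
      using UV verts_N by (intro N.reachable_refl) auto
    ultimately show ?thesis by simp
  qed

  have "strongly_connected ?N"
  proof
    have "P \<noteq> {}" using cardP by auto
    then show "verts ?N \<noteq> {}"
      using nonempty verts_N by auto
  next
    fix u v assume "u \<in> verts ?N" "v \<in> verts ?N"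
    then obtain U V where UV: "U \<in> P" "V \<in> P" "u \<in> U" "v \<in> V"
      using verts_N by auto
    \<comment> \<open>The detour through a third set also handles \<open>U = V\<close>.\<close>
    obtain X where X: "X \<in> P" "X \<notin> {U, V}"
      using obtain_two_outside[OF finP cardP UV(1,2)] by metis
    obtain x where "x \<in> X"
      using nonempty X by blast
    with UV X have "u \<rightarrow>\<^sup>*\<^bsub>?N\<^esub> x" "x \<rightarrow>\<^sup>*\<^bsub>?N\<^esub> v"
      using diff[of U X u x] diff[of X V x v] by auto
    then show "u \<rightarrow>\<^sup>*\<^bsub>?N\<^esub> v"
      by (rule N.reachable_trans)
  qed
  then show ?thesis
    \<comment> \<open>\<open>connected\<close> means strong connectivity of the symmetric closure,
      to which reachability lifts.\<close>
    unfolding connected_def strongly_connected_def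
    using N.reachable_mk_symmetricI by simp
qed

end
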